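(* Fix an integer $k\ge2$, a sample $X_1,\dots,X_n\in\mathbb{R}$, and let $\ell_n(\theta)=\sum_{i=1}^n\log f_\theta(X_i)$ be the Gaussian mixture log-likelihood. For each fixed $m\ge1$ and $\varepsilon\in(0,1/k]$, $\ell_n$ attains its maximum on $\mathcal S_{m,\varepsilon}$.
   Context: For $\theta=(\pi,\mu,t)$ with $\pi\in\Delta_{k-1}=\{\pi\in[0,1]^k:\sum_j\pi_j=1\}$, $\mu\in\mathbb{R}^k$, $t\in\mathbb{R}^k$ and $\sigma_j=e^{t_j}$, the $k$-component Gaussian mixture density is $f_\theta(x)=\sum_{j=1}^k\pi_j\varphi(x;\mu_j,\sigma_j)$, where $\varphi(x;\mu,\sigma)=\frac{1}{\sqrt{2\pi}\,\sigma}\exp(-\frac{(x-\mu)^2}{2\sigma^2})$. The sieve is $\mathcal S_{m,\varepsilon}=\{\pi\in\Delta_{k-1}:\min_j\pi_j\ge\varepsilon\}\times[-m,m]^k\times[-m,m]^k$, in coordinates $(\pi,\mu,t)$. *)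

theory Defs
  imports "HOL-Probability.Probability"
begin

text \<open>
  The number of components is the cardinality of the finite index type 'k.
  A parameter is a triple of vectors (weights, means, log standard deviations), so the
  standard deviation of component j is exp (t $ j), which is positive; hence the library
  constant normal_density, with prefactor 1 / sqrt (2 * pi * sigma^2), agrees with the
  prefactor 1 / (sqrt (2 * pi) * sigma).
\<close>

type_synonym 'k mixture_param = "(real ^ 'k) \<times> (real ^ 'k) \<times> (real ^ 'k)"

definition prob_simplex :: "(real ^ 'k::finite) set" where
  "prob_simplex = {\<pi>. (\<forall>j. \<pi> $ j \<in> {0..1}) \<and> (\<Sum>j\<in>UNIV. \<pi> $ j) = 1}"

definition mixture_density :: "'k::finite mixture_param \<Rightarrow> real \<Rightarrow> real" where
  "mixture_density = (\<lambda>(\<pi>, \<mu>, t) x. \<Sum>j\<in>UNIV. \<pi> $ j * normal_density (\<mu> $ j) (exp (t $ j)) x)"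

definition log_likelihood :: "nat \<Rightarrow> (nat \<Rightarrow> real) \<Rightarrow> 'k::finite mixture_param \<Rightarrow> real" where
  "log_likelihood n X \<theta> = (\<Sum>i = 1..n. ln (mixture_density \<theta> (X i)))"

definition sieve :: "real \<Rightarrow> real \<Rightarrow> 'k::finite mixture_param set" where
  "sieve m \<epsilon> =
     {\<pi> \<in> prob_simplex. Min (range (\<lambda>j. \<pi> $ j)) \<ge> \<epsilon>}
       \<times> {\<mu>. \<forall>j. \<mu> $ j \<in> {-m..m}} \<times> {t. \<forall>j. t $ j \<in> {-m..m}}"

end

theory Submission
  imports Defs
begin

text \<open>This is the extreme value theorem: a continuous real function on a nonempty compact set
  attains its maximum. In the coordinates (\<pi>, \<mu>, t) the sieve is a product of closed bounded
  sets (\<open>compact_sieve\<close>). Continuity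
  (\<open>continuous_on_log_likelihood_sieve\<close>) could only fail where a standard deviation or
  the density vanishes. The first is excluded by \<sigma> = exp t, the second by the floor
  \<epsilon> > 0 on the weights.\<close>

lemma compact_vec_box: "compact {x :: real ^ 'k. \<forall>j. x $ j \<in> {a..b}}"
proof -
  have "{x :: real ^ 'k. \<forall>j. x $ j \<in> {a..b}} = cbox (\<chi> j. a) (\<chi> j. b)"
    by (auto simp: mem_box_cart)
  then show ?thesis by (metis compact_cbox)
qed

text \<open>Trades the minimum over the weights for an intersection of closed half-spaces, so that
  the weight factor is visibly a compact cube cut by closed sets.\<close>

lemma sieve_eq:
  "(sieve m \<epsilon> :: 'k::finite mixture_param set) =
     ({\<pi>. \<forall>j. \<pi> $ j \<in> {0..1}} \<inter> {\<pi>. (\<Sum>j\<in>UNIV. \<pi> $ j) = 1} \<inter> (\<Inter>j. {\<pi>. \<epsilon> \<le> \<pi> $ j}))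
       \<times> {\<mu>. \<forall>j. \<mu> $ j \<in> {-m..m}} \<times> {t. \<forall>j. t $ j \<in> {-m..m}}"
  by (auto simp: sieve_def prob_simplex_def)

lemma compact_sieve: "compact (sieve m \<epsilon> :: 'k::finite mixture_param set)"
  unfolding sieve_eq
  by (intro compact_Times compact_Int_closed compact_vec_box closed_INT ballI
      closed_Collect_eq closed_Collect_le continuous_intros)

lemma sieve_nonempty:
  assumes "m \<ge> 0" "\<epsilon> \<le> 1 / real CARD('k::finite)"
  shows "(sieve m \<epsilon> :: 'k mixture_param set) \<noteq> {}"
proof -
  \<comment> \<open>Uniform weights meet the floor exactly because \<epsilon> is at most 1/k; zero
    lies in both boxes since m \<ge> 0.\<close>
  have "((\<chi> j. 1 / real CARD('k)), 0, 0) \<in> (sieve m \<epsilon> :: 'k mixture_param set)"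
    using assms by (auto simp: sieve_eq divide_le_eq)
  then show ?thesis by blast
qed

text \<open>Holds on any set \<open>S\<close>: the denominators in the Gaussian never vanish, as
  \<open>exp (t $ j)\<close> is positive.\<close>

lemma continuous_on_mixture_density:
  "continuous_on S (\<lambda>\<theta> :: 'k::finite mixture_param. mixture_density \<theta> x)"
  unfolding mixture_density_def case_prod_beta normal_density_def
  by (intro continuous_intros) auto

lemma mixture_density_pos:
  assumes "\<And>j. 0 < \<pi> $ j"
  shows "0 < mixture_density (\<pi>, \<mu>, t) x"
  unfolding mixture_density_def prod.case
  by (intro sum_pos mult_pos_pos assms normal_density_pos) auto

lemma continuous_on_log_likelihood_sieve:
  assumes "0 < \<epsilon>"
  shows "continuous_on (sieve m \<epsilon>) (log_likelihood n X :: 'k::finite mixture_param \<Rightarrow> real)"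
proof -
  \<comment> \<open>Continuity of \<open>ln\<close> on the reals asks for a nonzero argument; here
    each weight is at least \<epsilon> > 0, which makes the density positive.\<close>
  have "mixture_density \<theta> x \<noteq> 0" if "\<theta> \<in> sieve m \<epsilon>" for \<theta> :: "'k mixture_param" and x
  proof -
    obtain \<pi> \<mu> t where \<theta>: "\<theta> = (\<pi>, \<mu>, t)" by (cases \<theta>)
    have "0 < \<pi> $ j" for j
      using that assms order_less_le_trans unfolding \<theta> sieve_eq by blast
    then show ?thesis
      unfolding \<theta> using mixture_density_pos by (metis less_irrefl)
  qed
  then show ?thesis
    unfolding log_likelihood_def
    by (intro continuous_on_sum continuous_on_ln continuous_on_mixture_density) blast
qed

theorem proposition4p7:
  fixes n :: nat and X :: "nat \<Rightarrow> real" and m \<epsilon> :: real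
  assumes "CARD('k::finite) \<ge> 2"
    and "m \<ge> 1"
    and "0 < \<epsilon>" and "\<epsilon> \<le> 1 / real CARD('k)"
  shows "\<exists>\<theta> \<in> (sieve m \<epsilon> :: 'k mixture_param set). \<forall>\<theta>' \<in> (sieve m \<epsilon> :: 'k mixture_param set).
           log_likelihood n X \<theta>' \<le> log_likelihood n X \<theta>"
  using assms
  by (intro continuous_attains_sup compact_sieve sieve_nonempty
      continuous_on_log_likelihood_sieve) auto

end
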